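(* Let $m\ge 1$, $n\ge 1$ and $1\le k\le n$ be integers. Let $X_1,\dots,X_m$ be independent real random variables with probability densities $f_{X_1},\dots,f_{X_m}$, and write $f_X=f_{X_1}$. Let $U=\prod_{i=1}^m X_i$ with cumulative distribution function $F_U$, and let $V=\prod_{i=2}^m X_i$. Then the first factor $\tilde X$ of the $k$-th order statistic of a length-$n$ sample of the product $U$ has density $$f_{\tilde X}(x)=\frac{n!}{(k-1)!\,(n-k)!}\,f_X(x)\,\mathbb{E}_V\left\{F_U(xV)^{k-1}\bigl(1-F_U(xV)\bigr)^{n-k}\right\},$$ where $\mathbb{E}_V\{\cdot\}$ denotes expectation with respect to the distribution of $V$.
   Context: A length-$n$ sample of the product is built as follows: let $(X_{j,1},\dots,X_{j,m})$, $j=1,\dots,n$, be $n$ independent copies of $(X_1,\dots,X_m)$, and put $U_j=\prod_{i=1}^m X_{j,i}$. The $k$-th order statistic $U_{(k,n)}$ is the $k$-th smallest of $U_1,\dots,U_n$ (almost surely there are no ties, since $U$ has a density). Let $J$ be the almost surely unique index with $U_J=U_{(k,n)}$. The first factor of the $k$-th order statistic is the random variable $\tilde X:=X_{J,1}$, i.e. the first factor in the row whose product is the $k$-th smallest. For $m=1$ the empty product $V$ is $1$. As usual, identities between densities are understood for almost every $x$. *)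

theory Defs
  imports "HOL-Probability.Probability"
begin

definition order_statistic :: "nat \<Rightarrow> nat \<Rightarrow> (nat \<Rightarrow> 'a \<Rightarrow> real) \<Rightarrow> 'a \<Rightarrow> real" where
  "order_statistic k n U \<omega> = sort (map (\<lambda>j. U j \<omega>) [1..<Suc n]) ! (k - 1)"

text \<open>
  The rows of \<open>Y\<close>, viewed as random elements of \<open>\<real>\<^sup>m\<close>, are independent and each has the
  same joint distribution as \<open>X\<close>. The two families may live on different probability spaces.
\<close>

definition independent_copies ::
  "'a measure \<Rightarrow> nat \<Rightarrow> (nat \<Rightarrow> 'a \<Rightarrow> real) \<Rightarrow>
   'b measure \<Rightarrow> nat \<Rightarrow> (nat \<Rightarrow> nat \<Rightarrow> 'b \<Rightarrow> real) \<Rightarrow> bool" where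
  "independent_copies M m X N n Y \<longleftrightarrow>
     prob_space.indep_vars N (\<lambda>_. \<Pi>\<^sub>M i\<in>{1..m}. borel)
       (\<lambda>j \<omega>. \<lambda>i\<in>{1..m}. Y j i \<omega>) {1..n} \<and>
     (\<forall>j\<in>{1..n}.
        distr N (\<Pi>\<^sub>M i\<in>{1..m}. borel) (\<lambda>\<omega>. \<lambda>i\<in>{1..m}. Y j i \<omega>) =
        distr M (\<Pi>\<^sub>M i\<in>{1..m}. borel) (\<lambda>\<omega>. \<lambda>i\<in>{1..m}. X i \<omega>))"

text \<open>
  \<open>J\<close> is a random index in \<open>{1..n}\<close> at which the \<open>k\<close>-th order statistic is almost surely
  attained; no tie-breaking rule is prescribed. For samples from a distribution with a density
  any two such indices agree almost surely.
\<close>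

definition order_index ::
  "'a measure \<Rightarrow> nat \<Rightarrow> nat \<Rightarrow> (nat \<Rightarrow> 'a \<Rightarrow> real) \<Rightarrow> ('a \<Rightarrow> nat) \<Rightarrow> bool" where
  "order_index N k n U J \<longleftrightarrow>
     J \<in> measurable N (count_space {1..n}) \<and>
     (AE \<omega> in N. U (J \<omega>) \<omega> = order_statistic k n U \<omega>)"

end

theory Submission imports Defs begin

text \<open>
  Almost surely the \<open>U\<^sub>j\<close> are distinct, because \<open>X\<^sub>1\<close> has a density and \<open>V \<noteq> 0\<close> almost surely. Hence
  \<open>J = j\<close> is, up to a null set, the event that exactly \<open>k - 1\<close> of the other \<open>U\<^sub>i\<close> are at most
  \<open>U\<^sub>j\<close>. Splitting it by the set of these \<open>i\<close> and conditioning on row \<open>j\<close>, independence gives the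
  binomial probability with success parameter \<open>F\<^sub>U(U\<^sub>j)\<close>. So the law of the row selected by \<open>J\<close> has
  density \<open>n! / ((k - 1)! (n - k)!) F\<^sub>U(U)\<^sup>k\<^sup>-\<^sup>1 (1 - F\<^sub>U(U))\<^sup>n\<^sup>-\<^sup>k\<close> with respect to the law of
  a row. Substituting \<open>U = X\<^sub>1 V\<close> with \<open>X\<^sub>1\<close> and \<open>V\<close> independent yields the claim.
\<close>

section \<open>Ranks and positions in a sorted list\<close>

text \<open>The product is nonzero for exactly one set, \<open>S = {i\<in>I. P i}\<close>, so at
  most one summand survives. Written this way, a counting event becomes a sum of products over
  \<open>i\<close>, which can be integrated factor by factor under independence.\<close>

lemma of_bool_card_eq:
  assumes "finite I"
  shows "of_bool (card {i\<in>I. P i} = k) =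
    (\<Sum>S | S \<subseteq> I \<and> card S = k. \<Prod>i\<in>I. of_bool (i \<in> S \<longleftrightarrow> P i) :: 'a :: comm_semiring_1)"
proof -
  have prod_eq: "(\<Prod>i\<in>A. of_bool (B i)) = (of_bool (\<forall>i\<in>A. B i) :: 'a)" if "finite A" for A :: "'b set" and B
    using that by induction auto
  have "(\<Sum>S | S \<subseteq> I \<and> card S = k. \<Prod>i\<in>I. of_bool (i \<in> S \<longleftrightarrow> P i) :: 'a) =
      (\<Sum>S | S \<subseteq> I \<and> card S = k. if S = {i\<in>I. P i} then 1 else 0)"
    by (rule sum.cong) (auto simp: prod_eq assms)
  also have "\<dots> = of_bool (card {i\<in>I. P i} = k)"
    using assms by (subst sum.delta) auto
  finally show ?thesis ..
qed

text \<open>Without ties the sorted list is strictly increasing, so the values up to the entry at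
  position \<open>k - 1\<close> are exactly those at positions \<open>0\<close> to
  \<open>k - 1\<close>. Injectivity of \<open>u\<close> carries this count of values back to
  indices.\<close>

lemma card_le_sort_nth:
  fixes u :: "nat \<Rightarrow> real"
  assumes "inj_on u {1..n}" "1 \<le> k" "k \<le> n"
  shows "card {i\<in>{1..n}. u i \<le> sort (map u [1..<Suc n]) ! (k - 1)} = k"
proof -
  define s where "s = sort (map u [1..<Suc n])"
  have set_s: "set s = u ` {1..n}"
    unfolding s_def by (auto simp del: upt_Suc)
  have len: "length s = n"
    by (simp add: s_def del: upt_Suc)
  have "distinct s"
    using assms(1) by (simp add: s_def distinct_map atLeastLessThanSuc_atLeastAtMost del: upt_Suc)
  moreover have "sorted s"
    by (simp add: s_def)
  ultimately have s: "sorted_wrt (<) s"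
    using strict_sorted_iff by blast
  have "u ` {i\<in>{1..n}. u i \<le> s ! (k - 1)} = {x\<in>set s. x \<le> s ! (k - 1)}"
    using set_s by auto
  also have "\<dots> = (!) s ` {..<k}"
  proof (intro equalityI subsetI)
    fix x assume "x \<in> {x\<in>set s. x \<le> s ! (k - 1)}"
    then obtain a where a: "a < n" "x = s ! a" "s ! a \<le> s ! (k - 1)"
      by (auto simp: in_set_conv_nth len)
    then have "\<not> k - 1 < a"
      using sorted_wrt_nth_less[OF s, of "k - 1" a] len by auto
    then have "a < k"
      using assms by linarith
    with a show "x \<in> (!) s ` {..<k}"
      by auto
  next
    fix x assume "x \<in> (!) s ` {..<k}"
    then show "x \<in> {x\<in>set s. x \<le> s ! (k - 1)}"
      using assms len \<open>sorted s\<close> by (auto intro!: sorted_nth_mono)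
  qed
  finally have "card (u ` {i\<in>{1..n}. u i \<le> s ! (k - 1)}) = card ((!) s ` {..<k})"
    by simp
  moreover have "inj_on ((!) s) {..<k}"
    using inj_on_nth[OF \<open>distinct s\<close>, of "{..<k}"] len assms by auto
  moreover have "inj_on u {i\<in>{1..n}. u i \<le> s ! (k - 1)}"
    by (rule inj_on_subset[OF assms(1)]) auto
  ultimately show ?thesis
    by (simp add: card_image s_def)
qed

text \<open>The sets \<open>{i. u i \<le> u a}\<close> are nested as \<open>a\<close> varies, so two
  of them of equal size coincide, which forces equal values and then equal indices. Leaving
  \<open>j\<close> out of the count lowers the rank from \<open>k\<close> to \<open>k - 1\<close>;
  what remains compares \<open>u j\<close> with the other values only, the form needed for
  conditioning on row \<open>j\<close>.\<close>

lemma nth_sort_iff_rank: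
  fixes u :: "nat \<Rightarrow> real"
  assumes inj: "inj_on u {1..n}" and "1 \<le> k" "k \<le> n"
    and J: "J \<in> {1..n}" "u J = sort (map u [1..<Suc n]) ! (k - 1)" and j: "j \<in> {1..n}"
  shows "J = j \<longleftrightarrow> card {i\<in>{1..n} - {j}. u i \<le> u j} = k - 1"
proof -
  have card_remove: "card {i\<in>{1..n}. u i \<le> u a} = Suc (card {i\<in>{1..n} - {a}. u i \<le> u a})" if "a \<in> {1..n}" for a
  proof -
    have "{i\<in>{1..n}. u i \<le> u a} = insert a {i\<in>{1..n} - {a}. u i \<le> u a}"
      using that by auto
    then show ?thesis
      by simp
  qed
  have rank_J: "card {i\<in>{1..n}. u i \<le> u J} = k"
    using card_le_sort_nth[OF assms(1-3)] J by simp
  show ?thesis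
  proof
    assume "J = j"
    then show "card {i\<in>{1..n} - {j}. u i \<le> u j} = k - 1"
      using rank_J card_remove[OF j] by simp
  next
    assume "card {i\<in>{1..n} - {j}. u i \<le> u j} = k - 1"
    then have eq: "card {i\<in>{1..n}. u i \<le> u j} = card {i\<in>{1..n}. u i \<le> u J}"
      using rank_J card_remove[OF j] \<open>1 \<le> k\<close> by simp
    have "{i\<in>{1..n}. u i \<le> u j} = {i\<in>{1..n}. u i \<le> u J}"
    proof (cases "u j \<le> u J")
      case True
      then show ?thesis
        using eq by (intro card_subset_eq) auto
    next
      case False
      then show ?thesis
        using eq by (intro card_subset_eq[symmetric]) auto
    qed
    then have "u J = u j"
      using J(1) j by (auto simp: set_eq_iff intro: antisym)
    then show "J = j"
      using inj J(1) j by (auto dest: inj_onD)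
  qed
qed

section \<open>The binomial law of a rank, given one row\<close>

text \<open>Given \<open>R j = r\<close>, the events \<open>g (R i) \<le> g r\<close> for the other
  \<open>i\<close> are independent with common probability \<open>F (g r)\<close>, so their number
  is binomial. The weight \<open>h\<close> serves as a test function that records the value of row
  \<open>j\<close>.\<close>

lemma (in prob_space) nn_integral_rank:
  fixes g :: "'c \<Rightarrow> real"
  assumes indep: "indep_vars (\<lambda>_. S) R I" and "finite I" "j \<in> I"
    and Q: "\<And>i. i \<in> I \<Longrightarrow> distr M S (R i) = Q"
    and g [measurable]: "g \<in> borel_measurable S" and h [measurable]: "h \<in> borel_measurable S"
    and F: "F = cdf (distr Q borel g)"
  shows "(\<integral>\<^sup>+\<omega>. h (R j \<omega>) * of_bool (card {i\<in>I - {j}. g (R i \<omega>) \<le> g (R j \<omega>)} = k) \<partial>M) =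
    (\<integral>\<^sup>+r. h r * ennreal (real (card I - 1 choose k) * F (g r) ^ k * (1 - F (g r)) ^ (card I - 1 - k)) \<partial>Q)"
proof -
  have rv [measurable]: "R i \<in> measurable M S" if "i \<in> I" for i
    using indep that by (auto simp: indep_vars_def)
  interpret Q: prob_space Q
    using Q[OF \<open>j \<in> I\<close>] prob_space_distr[OF rv[OF \<open>j \<in> I\<close>]] by simp
  have sets_Q [measurable_cong]: "sets Q = sets S"
    using Q[OF \<open>j \<in> I\<close>] sets_distr by metis
  have g': "g \<in> measurable Q borel"
    by measurable
  interpret G: prob_space "distr Q borel g"
    by (rule Q.prob_space_distr) measurable
  interpret P: product_sigma_finite "\<lambda>_. Q"
    by standard
  define I' where "I' = I - {j}"
  have I': "finite I'" "j \<notin> I'" "I = insert j I'" "card I' = card I - 1"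
    using assms by (auto simp: I'_def)
  \<comment> \<open>The flag \<open>b\<close> selects the outcome of one comparison:
    \<open>p True r\<close> integrates to \<open>F (g r)\<close> and \<open>p False r\<close> to
    \<open>1 - F (g r)\<close>.\<close>
  define p where "p b r s = (of_bool (b \<longleftrightarrow> g s \<le> g r) :: ennreal)" for b r s
  have "case_prod (p b) \<in> borel_measurable (S \<Otimes>\<^sub>M S)" for b
    unfolding p_def by measurable
  note p_meas = measurable_Pair_compose_split[OF this]
  have F_le: "F t \<le> 1" "0 \<le> F t" for t
    by (simp_all add: F cdf_def)
  have le: "(\<integral>\<^sup>+s. p True r s \<partial>Q) = ennreal (F (g r))" if "r \<in> space Q" for r
  proof -
    have "(\<integral>\<^sup>+s. p True r s \<partial>Q) = (\<integral>\<^sup>+s. indicator {..g r} (g s) \<partial>Q)"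
      by (auto simp: p_def indicator_def intro!: nn_integral_cong)
    also have "\<dots> = emeasure (distr Q borel g) {..g r}"
      by (subst nn_integral_distr[OF g', symmetric]) auto
    finally show ?thesis
      by (simp add: F cdf_def G.emeasure_eq_measure)
  qed
  have gt: "(\<integral>\<^sup>+s. p False r s \<partial>Q) = ennreal (1 - F (g r))" if "r \<in> space Q" for r
  proof -
    have "(\<integral>\<^sup>+s. p False r s \<partial>Q) = (\<integral>\<^sup>+s. indicator (space (distr Q borel g) - {..g r}) (g s) \<partial>Q)"
      by (auto simp: p_def indicator_def intro!: nn_integral_cong)
    also have "\<dots> = emeasure (distr Q borel g) (space (distr Q borel g) - {..g r})"
      by (subst nn_integral_distr[OF g', symmetric]) auto
    finally show ?thesis
      by (simp add: F cdf_def G.emeasure_eq_measure G.prob_compl[simplified])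
  qed
  have joint: "distr M (\<Pi>\<^sub>M i\<in>I. S) (\<lambda>\<omega>. \<lambda>i\<in>I. R i \<omega>) = (\<Pi>\<^sub>M i\<in>I. Q)"
    using indep_vars_iff_distr_eq_PiM'[where I = I and M' = "\<lambda>_. S" and X = R] indep rv \<open>j \<in> I\<close> Q
    by (auto cong: PiM_cong)
  define \<S> where "\<S> = {T. T \<subseteq> I' \<and> card T = k}"
  \<comment> \<open>The integrand becomes a function of the whole tuple of rows, so that its
    expectation can be computed under the product measure.\<close>
  define K where "K x = h (x j) * (\<Sum>T\<in>\<S>. \<Prod>i\<in>I'. p (i \<in> T) (x j) (x i))" for x
  have K_meas: "K \<in> borel_measurable (\<Pi>\<^sub>M i\<in>I. S)"
    unfolding K_def using \<open>j \<in> I\<close>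
    by (intro borel_measurable_times_ennreal borel_measurable_sum borel_measurable_prod_ennreal
        measurable_compose[OF _ h] p_meas measurable_component_singleton) (auto simp: I'_def)
  then have K_meas': "K \<in> borel_measurable (\<Pi>\<^sub>M i\<in>I. Q)"
    by (simp cong: measurable_cong_sets sets_PiM_cong add: sets_Q)
  have R_meas: "(\<lambda>\<omega>. \<lambda>i\<in>I. R i \<omega>) \<in> measurable M (\<Pi>\<^sub>M i\<in>I. S)"
    by (intro measurable_restrict rv)
  have "(\<integral>\<^sup>+\<omega>. h (R j \<omega>) * of_bool (card {i\<in>I - {j}. g (R i \<omega>) \<le> g (R j \<omega>)} = k) \<partial>M) =
      (\<integral>\<^sup>+\<omega>. h (R j \<omega>) * (\<Sum>T\<in>\<S>. \<Prod>i\<in>I'. p (i \<in> T) (R j \<omega>) (R i \<omega>)) \<partial>M)"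
    unfolding p_def \<S>_def I'_def[symmetric] by (subst of_bool_card_eq[OF I'(1)]) simp
  also have "\<dots> = (\<integral>\<^sup>+\<omega>. K (\<lambda>i\<in>I. R i \<omega>) \<partial>M)"
    using \<open>j \<in> I\<close> unfolding K_def
    by (intro nn_integral_cong arg_cong2[where f = "(*)"] sum.cong prod.cong) (auto simp: I'_def)
  also have "\<dots> = (\<integral>\<^sup>+x. K x \<partial>(\<Pi>\<^sub>M i\<in>I. Q))"
    unfolding joint[symmetric] by (subst nn_integral_distr[OF R_meas]) (simp_all add: K_meas)
  \<comment> \<open>Tonelli with coordinate \<open>j\<close> outermost: row \<open>j\<close> is
    frozen at \<open>r\<close> while the other rows are integrated out.\<close>
  also have "\<dots> = (\<integral>\<^sup>+r. \<integral>\<^sup>+x. K (x(j := r)) \<partial>(\<Pi>\<^sub>M i\<in>I'. Q) \<partial>Q)"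
    unfolding I'(3) using K_meas' unfolding I'(3) by (rule P.product_nn_integral_insert_rev[OF I'(1,2)])
  also have "\<dots> = (\<integral>\<^sup>+r. \<integral>\<^sup>+x. h r * (\<Sum>T\<in>\<S>. \<Prod>i\<in>I'. p (i \<in> T) r (x i)) \<partial>(\<Pi>\<^sub>M i\<in>I'. Q) \<partial>Q)"
    unfolding K_def by (intro nn_integral_cong arg_cong2[where f = "(*)"] sum.cong prod.cong) (auto simp: I'_def)
  also have "\<dots> = (\<integral>\<^sup>+r. h r * ennreal (real (card I - 1 choose k) * F (g r) ^ k * (1 - F (g r)) ^ (card I - 1 - k)) \<partial>Q)"
  proof (rule nn_integral_cong)
    fix r assume r: "r \<in> space Q"
    then have rS: "r \<in> space S"
      using sets_eq_imp_space_eq[OF sets_Q] by simp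
    have "(\<Prod>i\<in>I'. \<integral>\<^sup>+s. p (i \<in> T) r s \<partial>Q) = ennreal (F (g r) ^ k * (1 - F (g r)) ^ (card I - 1 - k))"
      if "T \<in> \<S>" for T
    proof -
      have T: "T \<subseteq> I'" "card T = k" "finite T"
        using that I'(1) finite_subset by (auto simp: \<S>_def)
      \<comment> \<open>The \<open>k\<close> indices in \<open>T\<close> each contribute
        \<open>F (g r)\<close>, the remaining ones \<open>1 - F (g r)\<close>. The value is the same
        for every \<open>T\<close>, so the sum over \<open>\<S>\<close> only adds the binomial
        coefficient.\<close>
      have "(\<Prod>i\<in>I'. \<integral>\<^sup>+s. p (i \<in> T) r s \<partial>Q) =
          (\<Prod>i\<in>T. \<integral>\<^sup>+s. p (i \<in> T) r s \<partial>Q) * (\<Prod>i\<in>I' - T. \<integral>\<^sup>+s. p (i \<in> T) r s \<partial>Q)"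
        by (subst prod.subset_diff[OF T(1) I'(1)]) (rule mult.commute)
      also have "\<dots> = ennreal (F (g r)) ^ k * ennreal (1 - F (g r)) ^ (card I' - k)"
        using T by (simp add: le[OF r] gt[OF r] card_Diff_subset)
      finally show ?thesis
        using F_le I'(4) by (simp add: ennreal_power ennreal_mult)
    qed
    moreover have "(\<integral>\<^sup>+x. h r * (\<Sum>T\<in>\<S>. \<Prod>i\<in>I'. p (i \<in> T) r (x i)) \<partial>(\<Pi>\<^sub>M i\<in>I'. Q)) =
        h r * (\<Sum>T\<in>\<S>. \<Prod>i\<in>I'. \<integral>\<^sup>+s. p (i \<in> T) r s \<partial>Q)"
    proof -
      have p_meas_Q: "p b r \<in> borel_measurable Q" for b
        using p_meas[where g = "\<lambda>_. r" and h = "\<lambda>s. s" and M = Q] rS by (simp add: sets_Q cong: measurable_cong_sets)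
      have prod_meas: "(\<lambda>x. \<Prod>i\<in>I'. p (i \<in> T) r (x i)) \<in> borel_measurable (\<Pi>\<^sub>M i\<in>I'. Q)" for T
        by (intro borel_measurable_prod_ennreal measurable_compose[OF _ p_meas_Q] measurable_component_singleton)
      then show ?thesis
        by (simp add: nn_integral_cmult nn_integral_sum P.product_nn_integral_prod[OF I'(1) p_meas_Q])
    qed
    moreover have "card \<S> = card I - 1 choose k"
      using n_subsets[OF I'(1)] I'(4) by (simp add: \<S>_def)
    ultimately show "(\<integral>\<^sup>+x. h r * (\<Sum>T\<in>\<S>. \<Prod>i\<in>I'. p (i \<in> T) r (x i)) \<partial>(\<Pi>\<^sub>M i\<in>I'. Q)) =
        h r * ennreal (real (card I - 1 choose k) * F (g r) ^ k * (1 - F (g r)) ^ (card I - 1 - k))"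
      using F_le by (simp add: ennreal_mult ennreal_of_nat_eq_real_of_nat mult.assoc)
  qed
  finally show ?thesis .
qed

section \<open>Almost sure absence of ties\<close>

text \<open>By independence the joint law is a product measure, so Fubini lets one variable be
  frozen: if almost every section of the exceptional set is null, so is the set itself.\<close>

lemma (in prob_space) AE_indep_var:
  assumes indep: "indep_var S A T B"
    and P: "Measurable.pred (S \<Otimes>\<^sub>M T) (\<lambda>(a, b). P a b)"
    and AE: "AE b in distr M T B. AE \<omega> in M. P (A \<omega>) b"
  shows "AE \<omega> in M. P (A \<omega>) (B \<omega>)"
proof -
  have rv [measurable]: "A \<in> measurable M S" "B \<in> measurable M T"
    and joint: "distr M S A \<Otimes>\<^sub>M distr M T B = distr M (S \<Otimes>\<^sub>M T) (\<lambda>\<omega>. (A \<omega>, B \<omega>))"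
    using indep unfolding indep_var_distribution_eq by auto
  note P [measurable]
  interpret A: prob_space "distr M S A" by (rule prob_space_distr) fact
  interpret B: prob_space "distr M T B" by (rule prob_space_distr) fact
  interpret pair_sigma_finite "distr M S A" "distr M T B" ..
  have pair_set: "{x \<in> space (distr M S A \<Otimes>\<^sub>M distr M T B). P (fst x) (snd x)}
      \<in> sets (distr M S A \<Otimes>\<^sub>M distr M T B)"
    using predE[OF P] by (simp add: space_pair_measure case_prod_beta' cong: sets_pair_measure_cong)
  have "AE b in distr M T B. AE a in distr M S A. P a b"
    using AE AE_space by eventually_elim (subst AE_distr_iff, auto)
  then have "AE a in distr M S A. AE b in distr M T B. P a b"
    by (subst AE_commute[OF pair_set])
  then have "AE (a, b) in distr M S A \<Otimes>\<^sub>M distr M T B. P a b"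
    using pair_set by (intro AE_pair_measure) (simp_all only: case_prod_beta' fst_conv snd_conv)
  then show ?thesis
    unfolding joint by (subst (asm) AE_distr_iff) auto
qed

text \<open>Freezing \<open>W j\<close> at a value \<open>c\<close>, the independent
  \<open>W i\<close> avoids \<open>c\<close> almost surely. There are only finitely many pairs, so
  the exceptional null sets can be united.\<close>

lemma (in prob_space) AE_indep_vars_inj_on:
  fixes W :: "'i \<Rightarrow> 'a \<Rightarrow> real"
  assumes indep: "indep_vars (\<lambda>_. borel) W I" and "finite I"
    and no_atoms: "\<And>i c. i \<in> I \<Longrightarrow> AE \<omega> in M. W i \<omega> \<noteq> c"
  shows "AE \<omega> in M. inj_on (\<lambda>i. W i \<omega>) I"
proof -
  have "AE \<omega> in M. i \<noteq> j \<longrightarrow> W i \<omega> \<noteq> W j \<omega>" if "i \<in> I" "j \<in> I" for i j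
  proof (cases "i = j")
    case False
    \<comment> \<open>Joint independence yields independence of the tuples over \<open>{i}\<close>
      and \<open>{j}\<close>; projecting each to its only coordinate gives the pair.\<close>
    have "indep_var borel ((\<lambda>x. x i) \<circ> (\<lambda>\<omega>. \<lambda>l\<in>{i}. W l \<omega>)) borel ((\<lambda>x. x j) \<circ> (\<lambda>\<omega>. \<lambda>l\<in>{j}. W l \<omega>))"
      using False that by (intro indep_var_compose[OF indep_var_restrict[OF indep]]) auto
    then have "indep_var borel (W i) borel (W j)"
      by (simp add: comp_def)
    then have "AE \<omega> in M. W i \<omega> \<noteq> W j \<omega>"
      by (rule AE_indep_var) (use that no_atoms in auto)
    then show ?thesis
      by simp
  qed simp
  then have "AE \<omega> in M. \<forall>i\<in>I. \<forall>j\<in>I. i \<noteq> j \<longrightarrow> W i \<omega> \<noteq> W j \<omega>"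
    using \<open>finite I\<close> by (simp add: AE_finite_all)
  then show ?thesis
    by eventually_elim (auto simp: inj_on_def)
qed

section \<open>The law of the selected row\<close>

text \<open>Almost surely exactly one row has the required rank, and \<open>J\<close> points to it.
  Summing the rank integrals over \<open>j\<close> gives \<open>n\<close> equal terms, since each
  depends on \<open>j\<close> only through the common law \<open>Q\<close>.\<close>

lemma (in prob_space) nn_integral_order_index:
  fixes g :: "'c \<Rightarrow> real"
  assumes "1 \<le> k" "k \<le> n"
    and indep: "indep_vars (\<lambda>_. S) R {1..n}"
    and Q: "\<And>i. i \<in> {1..n} \<Longrightarrow> distr M S (R i) = Q"
    and g [measurable]: "g \<in> borel_measurable S" and h [measurable]: "h \<in> borel_measurable S"
    and F: "F = cdf (distr Q borel g)"
    and no_atoms: "\<And>c. AE r in Q. g r \<noteq> c"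
    and J: "order_index M k n (\<lambda>j \<omega>. g (R j \<omega>)) J"
  shows "(\<integral>\<^sup>+\<omega>. h (R (J \<omega>) \<omega>) \<partial>M) =
    (\<integral>\<^sup>+r. h r * ennreal (fact n / (fact (k - 1) * fact (n - k)) *
       (F (g r) ^ (k - 1) * (1 - F (g r)) ^ (n - k))) \<partial>Q)"
proof -
  have rv [measurable]: "R i \<in> measurable M S" if "i \<in> {1..n}" for i
    using indep that by (auto simp: indep_vars_def)
  have J_meas: "J \<in> measurable M (count_space {1..n})"
    and J_AE: "AE \<omega> in M. g (R (J \<omega>) \<omega>) = order_statistic k n (\<lambda>j \<omega>. g (R j \<omega>)) \<omega>"
    using J by (auto simp: order_index_def)
  have sets_Q [measurable_cong]: "sets Q = sets S"
    using Q[of 1] assms(1,2) sets_distr[of M S "R 1"] by simp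
  have "indep_vars (\<lambda>_. borel) (\<lambda>i \<omega>. g (R i \<omega>)) {1..n}"
    using indep_vars_compose2[OF indep, of "\<lambda>_. g" "\<lambda>_. borel"] by simp
  then have "AE \<omega> in M. inj_on (\<lambda>i. g (R i \<omega>)) {1..n}"
  proof (rule AE_indep_vars_inj_on)
    fix i and c :: real assume i: "i \<in> {1..n}"
    have "AE r in distr M S (R i). g r \<noteq> c"
      unfolding Q[OF i] by (rule no_atoms)
    then show "AE \<omega> in M. g (R i \<omega>) \<noteq> c"
      using i by (subst (asm) AE_distr_iff) auto
  qed simp
  \<comment> \<open>Off the null set of ties, \<open>J\<close> is determined by the ranks
    alone.\<close>
  then have AE_J: "AE \<omega> in M. \<forall>j\<in>{1..n}. J \<omega> = j \<longleftrightarrow>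
      card {i\<in>{1..n} - {j}. g (R i \<omega>) \<le> g (R j \<omega>)} = k - 1"
    using J_AE AE_space
  proof eventually_elim
    case (elim \<omega>)
    have "J \<omega> \<in> {1..n}"
      using measurable_space[OF J_meas elim(3)] by simp
    then show ?case
      using nth_sort_iff_rank[OF elim(1) assms(1,2)] elim(2) by (auto simp: order_statistic_def)
  qed
  interpret Q: prob_space Q
    using Q[of 1] prob_space_distr[OF rv[of 1]] assms(1,2) by simp
  interpret G: real_distribution "distr Q borel g"
    by (intro Q.real_distribution_distr) measurable
  have F_le: "F t \<le> 1" "0 \<le> F t" for t
    unfolding F by (simp_all add: G.cdf_bounded_prob G.cdf_nonneg)
  have [measurable]: "F \<in> borel_measurable borel"
    unfolding F by (intro borel_measurable_mono monoI G.cdf_nondecreasing)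
  \<comment> \<open>The constant combines \<open>n\<close> choices of the selected row with the
    choice of the \<open>k - 1\<close> rows below it. Here
    \<open>(n - 1) - (k - 1) = n - k\<close>.\<close>
  have "n * (n - 1 choose (k - 1)) * (fact (k - 1) * fact (n - k)) = (fact n :: nat)"
    using binomial_fact_lemma[of "k - 1" "n - 1"] assms(1,2) fact_reduce[of n, where 'a=nat]
    by (simp add: mult.commute mult.left_commute)
  then have "real n * real (n - 1 choose (k - 1)) * (fact (k - 1) * fact (n - k)) = fact n"
    by (metis of_nat_fact of_nat_mult)
  then have coeff: "fact n / (fact (k - 1) * fact (n - k)) = real n * real (n - 1 choose (k - 1))"
    by (simp add: field_simps)
  have "(\<integral>\<^sup>+\<omega>. h (R (J \<omega>) \<omega>) \<partial>M) = (\<integral>\<^sup>+\<omega>. (\<Sum>j\<in>{1..n}. h (R j \<omega>) *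
      of_bool (card {i\<in>{1..n} - {j}. g (R i \<omega>) \<le> g (R j \<omega>)} = k - 1)) \<partial>M)"
  proof (rule nn_integral_cong_AE, use AE_J AE_space in eventually_elim)
    case (elim \<omega>)
    have "J \<omega> \<in> {1..n}"
      using measurable_space[OF J_meas elim(2)] by simp
    then have "h (R (J \<omega>) \<omega>) = (\<Sum>j\<in>{1..n}. if J \<omega> = j then h (R j \<omega>) else 0)"
      by (simp add: sum.delta')
    also have "\<dots> = (\<Sum>j\<in>{1..n}. h (R j \<omega>) * of_bool (card {i\<in>{1..n} - {j}. g (R i \<omega>) \<le> g (R j \<omega>)} = k - 1))"
      using elim(1) by (intro sum.cong) auto
    finally show ?case .
  qed
  also have "\<dots> = (\<Sum>j\<in>{1..n}. \<integral>\<^sup>+\<omega>. h (R j \<omega>) *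
      of_bool (card {i\<in>{1..n} - {j}. g (R i \<omega>) \<le> g (R j \<omega>)} = k - 1) \<partial>M)"
    by (rule nn_integral_sum) measurable
  also have "\<dots> = (\<Sum>j\<in>{1..n}. \<integral>\<^sup>+r. h r * ennreal (real (n - 1 choose (k - 1)) * F (g r) ^ (k - 1) *
      (1 - F (g r)) ^ (n - k)) \<partial>Q)"
    using nn_integral_rank[OF indep _ _ Q g h F, where k = "k - 1"] assms(1,2) by (intro sum.cong) auto
  also have "\<dots> = of_nat n * (\<integral>\<^sup>+r. h r * ennreal (real (n - 1 choose (k - 1)) * F (g r) ^ (k - 1) *
      (1 - F (g r)) ^ (n - k)) \<partial>Q)"
    by simp
  also have "\<dots> = (\<integral>\<^sup>+r. of_nat n * (h r * ennreal (real (n - 1 choose (k - 1)) * F (g r) ^ (k - 1) *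
      (1 - F (g r)) ^ (n - k))) \<partial>Q)"
    by (rule nn_integral_cmult[symmetric]) measurable
  also have "\<dots> = (\<integral>\<^sup>+r. h r * ennreal (fact n / (fact (k - 1) * fact (n - k)) *
       (F (g r) ^ (k - 1) * (1 - F (g r)) ^ (n - k))) \<partial>Q)"
    unfolding coeff using F_le
    by (intro nn_integral_cong) (simp add: ennreal_mult ennreal_of_nat_eq_real_of_nat ac_simps)
  finally show ?thesis .
qed

section \<open>Integrals and null sets for variables with a density\<close>

text \<open>Tonelli for the product of the two laws, the first rewritten through its density.
  \<open>L\<close> and \<open>S\<close> share only their sigma-algebra, so the density can refer to
  \<open>lborel\<close> while independence is stated over \<open>borel\<close>.\<close>

lemma (in prob_space) nn_integral_indep_var_distributed:
  assumes indep: "indep_var S X T Y" and X: "distributed M L X f" and [measurable_cong]: "sets L = sets S"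
    and \<phi> [measurable]: "(\<lambda>(x, y). \<phi> x y) \<in> borel_measurable (S \<Otimes>\<^sub>M T)"
  shows "(\<integral>\<^sup>+\<omega>. \<phi> (X \<omega>) (Y \<omega>) \<partial>M) = (\<integral>\<^sup>+x. f x * (\<integral>\<^sup>+y. \<phi> x y \<partial>distr M T Y) \<partial>L)"
proof -
  have rv [measurable]: "X \<in> measurable M S" "Y \<in> measurable M T"
    and joint: "distr M S X \<Otimes>\<^sub>M distr M T Y = distr M (S \<Otimes>\<^sub>M T) (\<lambda>\<omega>. (X \<omega>, Y \<omega>))"
    using indep unfolding indep_var_distribution_eq by auto
  have [measurable]: "f \<in> borel_measurable L"
    and distr_X: "distr M S X = density L f"
    using X distr_cong[of M M S L X X] \<open>sets L = sets S\<close> by (auto simp: distributed_def)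
  interpret Y: prob_space "distr M T Y" by (rule prob_space_distr) fact
  have "(\<integral>\<^sup>+\<omega>. \<phi> (X \<omega>) (Y \<omega>) \<partial>M) = (\<integral>\<^sup>+(x, y). \<phi> x y \<partial>(distr M S X \<Otimes>\<^sub>M distr M T Y))"
    unfolding joint by (subst nn_integral_distr) auto
  also have "\<dots> = (\<integral>\<^sup>+x. \<integral>\<^sup>+y. \<phi> x y \<partial>distr M T Y \<partial>distr M S X)"
    by (subst Y.nn_integral_fst[symmetric]) auto
  also have "\<dots> = (\<integral>\<^sup>+x. f x * (\<integral>\<^sup>+y. \<phi> x y \<partial>distr M T Y) \<partial>L)"
    unfolding distr_X by (subst nn_integral_density) auto
  finally show ?thesis .
qed

lemma (in prob_space) AE_distributed_lborel_neq:
  fixes X :: "'a \<Rightarrow> real"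
  assumes X: "distributed M lborel X f"
  shows "AE \<omega> in M. X \<omega> \<noteq> c"
proof -
  have [measurable]: "X \<in> borel_measurable M" "f \<in> borel_measurable lborel"
    using X by (auto simp: distributed_def)
  have "AE x in lborel. x \<noteq> c"
    by (rule AE_lborel_singleton)
  then have "AE x in density lborel f. x \<noteq> c"
    by (subst AE_density) auto
  then have "AE x in distr M lborel X. x \<noteq> c"
    by (simp only: distributed_distr_eq_density[OF X])
  then show ?thesis
    by (subst (asm) AE_distr_iff) auto
qed

section \<open>The density of the selected first factor\<close>

theorem proposition2:
  fixes M :: "'a measure" and N :: "'b measure"
    and m n k :: nat
    and X :: "nat \<Rightarrow> 'a \<Rightarrow> real" and f :: "nat \<Rightarrow> real \<Rightarrow> real"
    and Y :: "nat \<Rightarrow> nat \<Rightarrow> 'b \<Rightarrow> real" and J :: "'b \<Rightarrow> nat"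
    and U V :: "'a \<Rightarrow> real" and F_U :: "real \<Rightarrow> real"
  assumes "m \<ge> 1" and "n \<ge> 1" and "1 \<le> k" and "k \<le> n"
    and "prob_space M" and "prob_space N"
    and "prob_space.indep_vars M (\<lambda>_. borel) X {1..m}"
    and "\<And>i x. i \<in> {1..m} \<Longrightarrow> 0 \<le> f i x"
    and "\<And>i. i \<in> {1..m} \<Longrightarrow> distributed M lborel (X i) (\<lambda>x. ennreal (f i x))"
    and "U = (\<lambda>\<omega>. \<Prod>i\<in>{1..m}. X i \<omega>)"
    and "V = (\<lambda>\<omega>. \<Prod>i\<in>{2..m}. X i \<omega>)"
    and "F_U = cdf (distr M borel U)"
    and "independent_copies M m X N n Y"
    and "order_index N k n (\<lambda>j \<omega>. \<Prod>i\<in>{1..m}. Y j i \<omega>) J"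
  shows "distributed N lborel (\<lambda>\<omega>. Y (J \<omega>) 1 \<omega>)
    (\<lambda>x. ennreal (fact n / (fact (k - 1) * fact (n - k)) * f 1 x *
       (\<integral>v. F_U (x * v) ^ (k - 1) * (1 - F_U (x * v)) ^ (n - k) \<partial>(distr M borel V))))"
proof -
  interpret M: prob_space M by fact
  interpret N: prob_space N by fact
  note f_nonneg = assms(8) and dens = assms(9)
  define S :: "(nat \<Rightarrow> real) measure" where "S = (\<Pi>\<^sub>M i\<in>{1..m}. borel)"
  define R where "R = (\<lambda>j \<omega>. \<lambda>i\<in>{1..m}. Y j i \<omega>)"
  define row where "row = (\<lambda>\<omega>. \<lambda>i\<in>{1..m}. X i \<omega>)"
  define Q where "Q = distr M S row"
  define g :: "(nat \<Rightarrow> real) \<Rightarrow> real" where "g r = (\<Prod>i\<in>{1..m}. r i)" for r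
  define G where "G t = F_U t ^ (k - 1) * (1 - F_U t) ^ (n - k)" for t
  define c :: real where "c = fact n / (fact (k - 1) * fact (n - k))"
  have X_meas [measurable]: "X i \<in> borel_measurable M" if "i \<in> {1..m}" for i
    using assms(7) that by (auto simp: M.indep_vars_def)
  have row_meas [measurable]: "row \<in> measurable M S"
    unfolding S_def row_def by measurable
  have comp_meas: "(\<lambda>r. r i) \<in> borel_measurable S" if "i \<in> {1..m}" for i
    using that unfolding S_def by measurable
  have g_meas [measurable]: "g \<in> borel_measurable S"
    unfolding g_def S_def by measurable
  have one [simp]: "1 \<in> {1..m}" "Suc 0 \<in> {1..m}"
    using assms(1) by auto
  note [measurable] = X_meas[OF one(1)]
  \<comment> \<open>Splitting off the first factor gives \<open>U = X 1 * V\<close>. For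
    \<open>m = 1\<close> the set \<open>{2..m}\<close> is empty and \<open>V\<close> is constantly
    \<open>1\<close>.\<close>
  have m_split: "{1..m} = insert 1 {2..m}"
    using assms(1) by auto
  have U_eq: "U \<omega> = X 1 \<omega> * V \<omega>" for \<omega>
    unfolding assms(10,11) m_split by simp
  have V_meas [measurable]: "V \<in> borel_measurable M"
    unfolding assms(11) by measurable
  have U_meas [measurable]: "U \<in> borel_measurable M"
    unfolding U_eq[abs_def] by measurable
  have X1_V: "M.indep_var borel (X 1) borel V"
    unfolding assms(11) by (rule M.indep_vars_prod) (use assms(7) m_split in auto)
  have g_row: "g (row \<omega>) = U \<omega>" for \<omega>
    by (simp add: g_def row_def assms(10))
  have row_1: "row \<omega> 1 = X 1 \<omega>" for \<omega>
    using one by (simp add: row_def)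
  have g_R: "(\<lambda>j \<omega>. g (R j \<omega>)) = (\<lambda>j \<omega>. \<Prod>i\<in>{1..m}. Y j i \<omega>)"
    by (simp add: g_def R_def)
  have indep_R: "N.indep_vars (\<lambda>_. S) R {1..n}"
    using assms(13) by (simp add: independent_copies_def S_def R_def)
  have distr_R: "distr N S (R j) = Q" if "j \<in> {1..n}" for j
    using assms(13) that by (simp add: independent_copies_def S_def R_def Q_def row_def)
  have rv_R [measurable]: "R j \<in> measurable N S" if "j \<in> {1..n}" for j
    using indep_R that by (auto simp: N.indep_vars_def)
  have F: "F_U = cdf (distr Q borel g)"
    unfolding assms(12) Q_def by (subst distr_distr) (auto simp: comp_def g_row cong: distr_cong)
  interpret DU: real_distribution "distr M borel U"
    by (intro M.real_distribution_distr) measurable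
  have F_bounds: "0 \<le> F_U t" "F_U t \<le> 1" for t
    unfolding assms(12) by (simp_all add: DU.cdf_bounded_prob DU.cdf_nonneg)
  have [measurable]: "F_U \<in> borel_measurable borel"
    unfolding assms(12) by (intro borel_measurable_mono monoI DU.cdf_nondecreasing)
  then have G_meas [measurable]: "G \<in> borel_measurable borel"
    unfolding G_def by measurable
  have G_bounds: "0 \<le> G t" "G t \<le> 1" for t
    using F_bounds by (auto simp: G_def intro!: mult_le_one power_le_one)
  have c: "0 \<le> c"
    by (simp add: c_def)
  \<comment> \<open>For fixed \<open>v \<noteq> 0\<close> the equation \<open>X 1 * v = b\<close>
    pins \<open>X 1\<close> to the single value \<open>b / v\<close>, a null event. \<open>V\<close>
    is almost surely nonzero because each of its factors has a density.\<close>
  have U_no_atoms: "AE \<omega> in M. U \<omega> \<noteq> b" for b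
    unfolding U_eq
  proof (rule M.AE_indep_var[OF X1_V])
    have "AE \<omega> in M. \<forall>i\<in>{2..m}. X i \<omega> \<noteq> 0"
      using M.AE_distributed_lborel_neq[OF dens] by (intro AE_finite_allI) auto
    then have "AE \<omega> in M. V \<omega> \<noteq> 0"
      by eventually_elim (simp add: assms(11))
    then have "AE v in distr M borel V. v \<noteq> 0"
      by (subst AE_distr_iff) auto
    then show "AE v in distr M borel V. AE \<omega> in M. X 1 \<omega> * v \<noteq> b"
    proof eventually_elim
      case (elim v)
      have "AE \<omega> in M. X 1 \<omega> \<noteq> b / v"
        by (rule M.AE_distributed_lborel_neq[OF dens[OF one(1)]])
      then show ?case
        by eventually_elim (use elim in \<open>auto simp: field_simps\<close>)
    qed
  qed measurable
  have no_atoms: "AE r in Q. g r \<noteq> b" for b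
    unfolding Q_def using U_no_atoms[of b] by (subst AE_distr_iff) (auto simp: g_row)
  have J_meas: "J \<in> measurable N (count_space {1..n})"
    using assms(14) by (auto simp: order_index_def)
  have Y_eq: "Y (J \<omega>) 1 \<omega> = R (J \<omega>) \<omega> 1" for \<omega>
    using one by (simp add: R_def)
  \<comment> \<open>\<open>J\<close> takes countably many values, so the random row is glued from
    the measurable rows \<open>R j\<close> on the events \<open>J = j\<close>.\<close>
  have RJ_meas [measurable]: "(\<lambda>\<omega>. R (J \<omega>) \<omega>) \<in> measurable N S"
    by (rule measurable_compose_countable'[OF _ J_meas]) auto
  have YJ_meas: "(\<lambda>\<omega>. Y (J \<omega>) 1 \<omega>) \<in> borel_measurable N"
    unfolding Y_eq by (rule measurable_compose[OF RJ_meas comp_meas[OF one(1)]])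
  define E where "E x = (\<integral>v. G (x * v) \<partial>(distr M borel V))" for x
  interpret DV: prob_space "distr M borel V"
    by (rule M.prob_space_distr) measurable
  have E_meas [measurable]: "E \<in> borel_measurable borel"
    unfolding E_def by measurable
  have E_nonneg: "0 \<le> E x" for x
    unfolding E_def using G_bounds by (intro integral_nonneg_AE) auto
  \<comment> \<open>\<open>G\<close> takes values in \<open>[0, 1]\<close> and the law of
    \<open>V\<close> is a probability measure, so the integrand is integrable and the Bochner
    integral agrees with the nonnegative one.\<close>
  have nn_E: "(\<integral>\<^sup>+v. ennreal (G (x * v)) \<partial>distr M borel V) = ennreal (E x)" for x
    unfolding E_def using G_bounds
    by (intro nn_integral_eq_integral DV.integrable_const_bound[where B = 1]) auto
  have f1_meas [measurable]: "(\<lambda>x. ennreal (f 1 x)) \<in> borel_measurable borel"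
    using dens[OF one(1)] by (simp add: distributed_def)
  have dens_eq: "ennreal (c * f 1 x * E x) = ennreal c * ennreal (f 1 x) * ennreal (E x)" for x
    using c E_nonneg f_nonneg[OF one(1), of x] by (simp add: ennreal_mult)
  have "distributed N lborel (\<lambda>\<omega>. Y (J \<omega>) 1 \<omega>) (\<lambda>x. ennreal (c * f 1 x * E x))"
    unfolding distributed_def
  proof (intro conjI)
    show "distr N lborel (\<lambda>\<omega>. Y (J \<omega>) 1 \<omega>) = density lborel (\<lambda>x. ennreal (c * f 1 x * E x))"
    proof (rule measure_eqI)
      fix A assume "A \<in> sets (distr N lborel (\<lambda>\<omega>. Y (J \<omega>) 1 \<omega>))"
      then have A [measurable]: "A \<in> sets borel"
        by simp
      \<comment> \<open>With this test function the integral over the selected row is the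
        probability that its first factor lies in \<open>A\<close>.\<close>
      define h :: "(nat \<Rightarrow> real) \<Rightarrow> ennreal" where "h r = indicator A (r 1)" for r
      have h_meas [measurable]: "h \<in> borel_measurable S"
        unfolding h_def using comp_meas[OF one(1)] by measurable
      have "emeasure (distr N lborel (\<lambda>\<omega>. Y (J \<omega>) 1 \<omega>)) A = (\<integral>\<^sup>+x. indicator A x \<partial>distr N lborel (\<lambda>\<omega>. Y (J \<omega>) 1 \<omega>))"
        by simp
      also have "\<dots> = (\<integral>\<^sup>+\<omega>. h (R (J \<omega>) \<omega>) \<partial>N)"
        using YJ_meas by (subst nn_integral_distr) (auto simp: h_def Y_eq[simplified])
      also have "\<dots> = (\<integral>\<^sup>+r. h r * ennreal (c * G (g r)) \<partial>Q)"
        unfolding c_def G_def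
        by (rule N.nn_integral_order_index[OF assms(3,4) indep_R distr_R g_meas h_meas F no_atoms])
          (use assms(14) g_R in simp_all)
      \<comment> \<open>\<open>Q\<close> is the law of the original row \<open>X\<close>, so the
        integral moves back to \<open>M\<close>, where \<open>X 1\<close> and \<open>V\<close> are
        independent.\<close>
      also have "\<dots> = (\<integral>\<^sup>+\<omega>. indicator A (X 1 \<omega>) * ennreal (c * G (X 1 \<omega> * V \<omega>)) \<partial>M)"
        unfolding Q_def by (subst nn_integral_distr) (measurable, simp add: h_def g_row U_eq row_1[simplified])
      also have "\<dots> = (\<integral>\<^sup>+x. ennreal (f 1 x) *
          (\<integral>\<^sup>+v. indicator A x * ennreal (c * G (x * v)) \<partial>distr M borel V) \<partial>lborel)"
        by (rule M.nn_integral_indep_var_distributed[OF X1_V dens[OF one(1)]]) auto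
      also have "\<dots> = (\<integral>\<^sup>+x. ennreal (c * f 1 x * E x) * indicator A x \<partial>lborel)"
      proof (rule nn_integral_cong)
        fix x
        have "(\<integral>\<^sup>+v. indicator A x * ennreal (c * G (x * v)) \<partial>distr M borel V) =
            (\<integral>\<^sup>+v. (indicator A x * ennreal c) * ennreal (G (x * v)) \<partial>distr M borel V)"
          using c G_bounds by (simp add: ennreal_mult mult.assoc)
        also have "\<dots> = indicator A x * ennreal c * ennreal (E x)"
          by (subst nn_integral_cmult) (auto simp: nn_E)
        finally show "ennreal (f 1 x) * (\<integral>\<^sup>+v. indicator A x * ennreal (c * G (x * v)) \<partial>distr M borel V) =
            ennreal (c * f 1 x * E x) * indicator A x"
          unfolding dens_eq by (simp add: ac_simps)
      qed
      also have "\<dots> = emeasure (density lborel (\<lambda>x. ennreal (c * f 1 x * E x))) A"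
        unfolding dens_eq by (rule emeasure_density[symmetric]) measurable
      finally show "emeasure (distr N lborel (\<lambda>\<omega>. Y (J \<omega>) 1 \<omega>)) A =
          emeasure (density lborel (\<lambda>x. ennreal (c * f 1 x * E x))) A" .
    qed simp
  next
    show "(\<lambda>x. ennreal (c * f 1 x * E x)) \<in> borel_measurable lborel"
      unfolding dens_eq by measurable
  next
    show "(\<lambda>\<omega>. Y (J \<omega>) 1 \<omega>) \<in> measurable N lborel"
      using YJ_meas by simp
  qed
  then show ?thesis
    by (simp only: c_def E_def G_def)
qed

end
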